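(* Let $x\in\mathcal{C}^2([0,t_f])$ be a real-valued function, and let $x_M(t)$ be the composite Bernstein approximant of $x(t)$ with $K$ segments of order $N$ and time knots $0=t_0<t_1<\dots<t_K=t_f$ satisfying $|t_k-t_{k-1}|\le\frac{C_t}{K}$ for all $k=1,\dots,K$, where $C_t>0$ is independent of $K$. Then $$\Vert x_M(t)-x(t)\Vert\le\frac{A}{K^2N}\qquad\text{for all }t\in[0,t_f],$$ where $$A=\frac{C_t^2}{8}\max_{\tau\in[t_{k-1},t_k],\ k=1,\dots,K}|\ddot{x}(\tau)|.$$
   Context: $K,N\ge1$ are integers. For $k=1,\dots,K$ and $j=0,\dots,N$, the Bernstein basis on $I_k=[t_{k-1},t_k]$ is $$b_{j,N}^{[k]}(t)=\binom{N}{j}\frac{(t-t_{k-1})^j(t_k-t)^{N-j}}{(t_k-t_{k-1})^N}.$$ With $t_{k,j}=t_{k-1}+\frac{j}{N}(t_k-t_{k-1})$, the composite Bernstein approximant of $x$ is the function $x_M:[0,t_f]\to\mathbb{R}$ given by $$x_M(t)=\sum_{j=0}^N x(t_{k,j})\,b_{j,N}^{[k]}(t),\qquad t\in I_k,\ k=1,\dots,K.$$ (The index $M$ is $M+1=K(N+1)$, the total number of coefficients.) *)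

theory Defs
  imports "HOL-Analysis.Analysis"
begin

(* Derivatives on a closed interval S are taken within S, hence one-sided at the end points. *)
definition deriv_on :: "real set \<Rightarrow> (real \<Rightarrow> real) \<Rightarrow> real \<Rightarrow> real" where
  "deriv_on S f s = vector_derivative f (at s within S)"

definition C2_on :: "real set \<Rightarrow> (real \<Rightarrow> real) \<Rightarrow> bool" where
  "C2_on S f \<longleftrightarrow>
     f differentiable_on S \<and>
     deriv_on S f differentiable_on S \<and>
     continuous_on S (deriv_on S (deriv_on S f))"

(* The knots are given by t :: nat => real, of which only t 0, ..., t K matter. *)

definition segment :: "(nat \<Rightarrow> real) \<Rightarrow> nat \<Rightarrow> real set" where
  "segment t k = {t (k - 1)..t k}"

definition bernstein_basis :: "(nat \<Rightarrow> real) \<Rightarrow> nat \<Rightarrow> nat \<Rightarrow> nat \<Rightarrow> real \<Rightarrow> real" where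
  "bernstein_basis t N k j s =
     real (N choose j) * (s - t (k - 1)) ^ j * (t k - s) ^ (N - j) / (t k - t (k - 1)) ^ N"

definition node :: "(nat \<Rightarrow> real) \<Rightarrow> nat \<Rightarrow> nat \<Rightarrow> nat \<Rightarrow> real" where
  "node t N k j = t (k - 1) + real j / real N * (t k - t (k - 1))"

definition bernstein_segment ::
    "(nat \<Rightarrow> real) \<Rightarrow> nat \<Rightarrow> (real \<Rightarrow> real) \<Rightarrow> nat \<Rightarrow> real \<Rightarrow> real" where
  "bernstein_segment t N x k s = (\<Sum>j=0..N. x (node t N k j) * bernstein_basis t N k j s)"

(* An interior knot lies in two segments; the first one is used. The choice is immaterial,
   see composite_bernstein_eq below. The value outside [t 0, t K] is irrelevant. *)
definition composite_bernstein ::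
    "(nat \<Rightarrow> real) \<Rightarrow> nat \<Rightarrow> nat \<Rightarrow> (real \<Rightarrow> real) \<Rightarrow> real \<Rightarrow> real" where
  "composite_bernstein t K N x s =
     bernstein_segment t N x (LEAST k. k \<in> {1..K} \<and> s \<in> segment t k) s"

lemma bernstein_segment_left:
  assumes "t (k - 1) < t k"
  shows "bernstein_segment t N x k (t (k - 1)) = x (t (k - 1))"
proof -
  have "bernstein_segment t N x k (t (k - 1)) =
      (\<Sum>j=0..N. if j = 0 then x (t (k - 1)) else 0)"
    unfolding bernstein_segment_def
    using assms by (intro sum.cong) (auto simp: bernstein_basis_def node_def)
  then show ?thesis by simp
qed

lemma bernstein_segment_right:
  assumes "t (k - 1) < t k" "N \<ge> 1"
  shows "bernstein_segment t N x k (t k) = x (t k)"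
proof -
  have "bernstein_segment t N x k (t k) = (\<Sum>j=0..N. if j = N then x (t k) else 0)"
    unfolding bernstein_segment_def
    using assms by (intro sum.cong) (auto simp: bernstein_basis_def node_def)
  then show ?thesis by simp
qed

lemma composite_bernstein_eq:
  assumes N: "N \<ge> 1" and t: "\<And>k. k \<in> {1..K} \<Longrightarrow> t (k - 1) < t k"
    and k: "k \<in> {1..K}" and s: "s \<in> segment t k"
  shows "composite_bernstein t K N x s = bernstein_segment t N x k s"
proof -
  define m where "m = (LEAST k. k \<in> {1..K} \<and> s \<in> segment t k)"
  have m: "m \<in> {1..K} \<and> s \<in> segment t m"
    unfolding m_def by (rule LeastI[of _ k]) (use k s in simp)
  have "m \<le> k"
    unfolding m_def by (rule Least_le) (use k s in simp)
  have mono: "t i < t j" if "i < j" "j \<le> K" for i j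
    using that
  proof (induction j)
    case (Suc j)
    have "t j < t (Suc j)" using t[of "Suc j"] Suc.prems by simp
    moreover have "t i \<le> t j" using Suc by (cases "i = j") auto
    ultimately show ?case by simp
  qed simp
  have "bernstein_segment t N x m s = bernstein_segment t N x k s"
  proof (cases "m = k")
    case False
    with \<open>m \<le> k\<close> have "m \<le> k - 1" "m < k" by auto
    have le: "s \<le> t m" "t (k - 1) \<le> s" using m s by (auto simp: segment_def)
    have "m = k - 1"
    proof (rule ccontr)
      assume "m \<noteq> k - 1"
      with \<open>m \<le> k - 1\<close> have "t m < t (k - 1)" using k by (intro mono) auto
      with le show False by simp
    qed
    with le have "s = t m" "s = t (k - 1)" by auto
    then show ?thesis
      using bernstein_segment_right[of t m N x] bernstein_segment_left[of t k N x]
        t[of m] t[of k] N m k by metis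
  qed simp
  then show ?thesis by (simp add: composite_bernstein_def m_def)
qed

(* The supremum below is the maximum of |f| over all segments whenever f is continuous there. *)
definition max_abs_segments :: "(nat \<Rightarrow> real) \<Rightarrow> nat \<Rightarrow> (real \<Rightarrow> real) \<Rightarrow> real" where
  "max_abs_segments t K f = (SUP \<tau>\<in>(\<Union>k\<in>{1..K}. segment t k). \<bar>f \<tau>\<bar>)"

lemma max_abs_segments_is_max:
  assumes K: "K \<ge> 1" and t: "\<And>k. k \<in> {1..K} \<Longrightarrow> t (k - 1) < t k"
    and f: "continuous_on (\<Union>k\<in>{1..K}. segment t k) f"
  shows "\<exists>k\<in>{1..K}. \<exists>\<tau>\<in>segment t k. max_abs_segments t K f = \<bar>f \<tau>\<bar>"
    and "k \<in> {1..K} \<Longrightarrow> \<tau> \<in> segment t k \<Longrightarrow> \<bar>f \<tau>\<bar> \<le> max_abs_segments t K f"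
proof -
  let ?S = "\<Union>k\<in>{1..K}. segment t k"
  have "compact ?S" by (intro compact_UN) (auto simp: segment_def)
  moreover have "t 0 \<in> ?S" using K t[of 1] by (auto simp: segment_def intro!: bexI[of _ 1])
  moreover have "continuous_on ?S (\<lambda>\<tau>. \<bar>f \<tau>\<bar>)" using f by (intro continuous_intros)
  ultimately obtain \<tau>0 where *: "\<tau>0 \<in> ?S" "\<And>\<tau>. \<tau> \<in> ?S \<Longrightarrow> \<bar>f \<tau>\<bar> \<le> \<bar>f \<tau>0\<bar>"
    using continuous_attains_sup[of ?S "\<lambda>\<tau>. \<bar>f \<tau>\<bar>"] by blast
  then have eq: "max_abs_segments t K f = \<bar>f \<tau>0\<bar>"
    unfolding max_abs_segments_def by (intro cSup_eq_maximum) auto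
  show "\<exists>k\<in>{1..K}. \<exists>\<tau>\<in>segment t k. max_abs_segments t K f = \<bar>f \<tau>\<bar>"
    using * eq by auto
  show "k \<in> {1..K} \<Longrightarrow> \<tau> \<in> segment t k \<Longrightarrow> \<bar>f \<tau>\<bar> \<le> max_abs_segments t K f"
    using * eq by (metis UN_I)
qed

end

theory Submission
  imports Defs
begin

text \<open>
  On one segment of length \<open>h\<close> the Bernstein basis is the binomial distribution with success
  probability \<open>u = (s - t (k - 1)) / h\<close>: its weights sum to 1, the nodes have mean \<open>s\<close> and variance
  \<open>h\<^sup>2 u (1 - u) / N \<le> h\<^sup>2 / (4 N)\<close>. Averaging the Taylor expansion of \<open>x\<close> at \<open>s\<close> over the nodes
  kills the linear term and leaves at most half the maximum of \<open>\<bar>x''\<bar>\<close> times the variance.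
\<close>

lemma has_real_derivative_deriv_on:
  assumes "f differentiable_on S" "s \<in> S"
  shows "(f has_real_derivative deriv_on S f s) (at s within S)"
  using assms unfolding deriv_on_def differentiable_on_def
  by (simp add: has_real_derivative_iff_has_vector_derivative vector_derivative_works)

text \<open>Two uses of the mean value theorem: on \<open>f'\<close>, it makes \<open>f'\<close>
  monotone; on \<open>f\<close>, it turns the secant slope between \<open>s\<close> and
  \<open>y\<close> into a value of \<open>f'\<close> between them. Derivatives within
  \<open>{a..b}\<close> keep the end points admissible for \<open>s\<close> and
  \<open>y\<close>.\<close>

lemma second_derivative_nonneg_imp_above_tangent:
  fixes f :: "real \<Rightarrow> real"
  assumes f: "\<And>z. z \<in> {a..b} \<Longrightarrow> (f has_real_derivative f' z) (at z within {a..b})"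
    and f': "\<And>z. z \<in> {a..b} \<Longrightarrow> (f' has_real_derivative f'' z) (at z within {a..b})"
    and nonneg: "\<And>z. z \<in> {a..b} \<Longrightarrow> 0 \<le> f'' z"
    and s: "s \<in> {a..b}" and y: "y \<in> {a..b}"
  shows "f' s * (y - s) \<le> f y - f s"
proof -
  \<comment> \<open>Stated for an arbitrary pair \<open>g\<close>, \<open>g'\<close>, since it
    serves both \<open>f'\<close> with \<open>f''\<close> and \<open>f\<close> with
    \<open>f'\<close>.\<close>
  have mvt: "\<exists>\<xi>\<in>{p..q}. g q - g p = g' \<xi> * (q - p)"
    if g: "\<And>z. z \<in> {a..b} \<Longrightarrow> (g has_real_derivative g' z) (at z within {a..b})"
      and pq: "a \<le> p" "p \<le> q" "q \<le> b" for g g' :: "real \<Rightarrow> real" and p q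
  proof (rule mvt_very_simple[OF \<open>p \<le> q\<close>])
    fix z assume "p \<le> z" "z \<le> q"
    then have "(g has_real_derivative g' z) (at z within {p..q})"
      using pq by (intro has_field_derivative_subset[OF g]) auto
    then show "(g has_derivative (*) (g' z)) (at z within {p..q})"
      by (simp add: has_field_derivative_def)
  qed
  have mono: "f' p \<le> f' q" if pq: "a \<le> p" "p \<le> q" "q \<le> b" for p q
  proof -
    obtain \<xi> where "\<xi> \<in> {p..q}" and eq: "f' q - f' p = f'' \<xi> * (q - p)"
      using mvt[OF f' pq] by blast
    then have "0 \<le> f'' \<xi> * (q - p)" using nonneg[of \<xi>] pq by simp
    with eq show ?thesis by simp
  qed
  show ?thesis
  proof (cases "s \<le> y")
    case True
    then obtain \<xi> where \<xi>: "\<xi> \<in> {s..y}" and eq: "f y - f s = f' \<xi> * (y - s)"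
      using mvt[OF f, of s y] s y by auto
    have "f' s \<le> f' \<xi>" using \<xi> s y by (intro mono) auto
    then show ?thesis unfolding eq using True by (intro mult_right_mono) auto
  next
    case False
    then obtain \<xi> where \<xi>: "\<xi> \<in> {y..s}" and eq: "f s - f y = f' \<xi> * (s - y)"
      using mvt[OF f, of y s] s y by auto
    have "f' \<xi> \<le> f' s" using \<xi> s y by (intro mono) auto
    then have "f' \<xi> * (s - y) \<le> f' s * (s - y)" using False by (intro mult_right_mono) auto
    with eq show ?thesis by (simp add: algebra_simps)
  qed
qed

text \<open>Since \<open>\<bar>f'' z\<bar> \<le> M\<close>, both
  \<open>M / 2 * z\<^sup>2 - f z\<close> and \<open>M / 2 * z\<^sup>2 + f z\<close> are convex.
  Their tangent inequalities at \<open>s\<close> are the two halves of the absolute value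
  bound.\<close>

lemma second_order_Taylor_bound:
  fixes f :: "real \<Rightarrow> real"
  assumes f: "\<And>z. z \<in> {a..b} \<Longrightarrow> (f has_real_derivative f' z) (at z within {a..b})"
    and f': "\<And>z. z \<in> {a..b} \<Longrightarrow> (f' has_real_derivative f'' z) (at z within {a..b})"
    and M: "\<And>z. z \<in> {a..b} \<Longrightarrow> \<bar>f'' z\<bar> \<le> M"
    and s: "s \<in> {a..b}" and y: "y \<in> {a..b}"
  shows "\<bar>f y - f s - f' s * (y - s)\<bar> \<le> M / 2 * (y - s)\<^sup>2"
proof -
  have "c * (f y - f s - f' s * (y - s)) \<le> M / 2 * (y - s)\<^sup>2" if c: "c = 1 \<or> c = -1" for c :: real
  proof -
    have "(M * s - c * f' s) * (y - s) \<le> (M / 2 * y\<^sup>2 - c * f y) - (M / 2 * s\<^sup>2 - c * f s)"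
    proof (rule second_derivative_nonneg_imp_above_tangent[OF _ _ _ s y])
      fix z assume z: "z \<in> {a..b}"
      show "((\<lambda>z. M / 2 * z\<^sup>2 - c * f z) has_real_derivative M * z - c * f' z) (at z within {a..b})"
        by (rule derivative_eq_intros f z refl)+ simp
      show "((\<lambda>z. M * z - c * f' z) has_real_derivative M - c * f'' z) (at z within {a..b})"
        by (rule derivative_eq_intros f' z refl)+ simp
      show "0 \<le> M - c * f'' z" using M[OF z] c by auto
    qed
    \<comment> \<open>The quadratic parts combine to \<open>M / 2 * (y - s)\<^sup>2\<close>, the gap
      between the parabola and its tangent at \<open>s\<close>.\<close>
    then show ?thesis by (simp add: algebra_simps power2_eq_square)
  qed
  from this[of 1] this[of "-1"] show ?thesis unfolding abs_le_iff by simp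
qed

lemma sum_Bernstein_variance:
  "(\<Sum>j\<le>N. (real j - real N * u)\<^sup>2 * Bernstein N j u) = real N * u * (1 - u)"
proof -
  \<comment> \<open>The square is expanded in \<open>j * (j - 1)\<close>, \<open>j\<close> and 1,
    whose Bernstein sums are the known factorial moments.\<close>
  have "(real j - real N * u)\<^sup>2 * Bernstein N j u =
      real j * (real j - 1) * Bernstein N j u + (1 - 2 * real N * u) * (real j * Bernstein N j u)
      + (real N * u)\<^sup>2 * Bernstein N j u" for j
    by (simp add: algebra_simps power2_eq_square)
  then have "(\<Sum>j\<le>N. (real j - real N * u)\<^sup>2 * Bernstein N j u) =
      real N * (real N - 1) * u\<^sup>2 + (1 - 2 * real N * u) * (real N * u) + (real N * u)\<^sup>2 * 1"
    by (simp only: sum.distrib sum_distrib_left[symmetric] sum_kk_Bernstein sum_k_Bernstein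
        sum_Bernstein)
  then show ?thesis by (simp add: algebra_simps power2_eq_square)
qed

text \<open>The affine map of the segment onto the unit interval makes the moment identities for
  \<open>Bernstein\<close> available. The factor \<open>h ^ N\<close> is shared between the powers
  \<open>j\<close> and \<open>N - j\<close>.\<close>

lemma bernstein_basis_eq_Bernstein:
  assumes "t (k - 1) < t k" "j \<le> N"
  shows "bernstein_basis t N k j s = Bernstein N j ((s - t (k - 1)) / (t k - t (k - 1)))"
proof -
  define h where "h = t k - t (k - 1)"
  have "h > 0" using assms by (simp add: h_def)
  then have "1 - (s - t (k - 1)) / h = (t k - s) / h" by (simp add: field_simps h_def)
  moreover have "h ^ N = h ^ j * h ^ (N - j)" using assms by (simp flip: power_add)
  ultimately show ?thesis
    unfolding bernstein_basis_def Bernstein_def h_def[symmetric] by (simp add: power_divide)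
qed

lemma bernstein_segment_error:
  assumes N: "N \<ge> 1" and t: "t (k - 1) < t k"
    and f: "\<And>z. z \<in> segment t k \<Longrightarrow> (f has_real_derivative f' z) (at z within segment t k)"
    and f': "\<And>z. z \<in> segment t k \<Longrightarrow> (f' has_real_derivative f'' z) (at z within segment t k)"
    and M: "\<And>z. z \<in> segment t k \<Longrightarrow> \<bar>f'' z\<bar> \<le> M"
    and s: "s \<in> segment t k"
  shows "\<bar>bernstein_segment t N f k s - f s\<bar> \<le> M * (t k - t (k - 1))\<^sup>2 / (8 * real N)"
proof -
  define h where "h = t k - t (k - 1)"
  define u where "u = (s - t (k - 1)) / h"
  define B where "B = (\<lambda>j. Bernstein N j u)"
  define y where "y = node t N k"
  define R where "R = (\<lambda>j. f (y j) - f s - f' s * (y j - s))"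
  have h: "h > 0" using t by (simp add: h_def)
  have u: "0 \<le> u" "u \<le> 1" using s h by (auto simp: u_def h_def segment_def)
  have B_nonneg: "B j \<ge> 0" for j using u by (simp add: B_def Bernstein_nonneg)
  have s_eq: "s = t (k - 1) + h * u" using h by (simp add: u_def)
  have y_minus_s: "y j - s = h / N * (real j - real N * u)" for j
    unfolding y_def node_def h_def[symmetric] s_eq using N by (simp add: field_simps)
  \<comment> \<open>The Taylor bound needs the nodes, as well as \<open>s\<close>, to lie in the
    segment.\<close>
  have y_seg: "y j \<in> segment t k" if "j \<le> N" for j
  proof -
    have "0 \<le> real j / real N" "real j / real N \<le> 1" using that N by auto
    then have "0 \<le> real j / real N * h" "real j / real N * h \<le> h"
      using h mult_right_mono[of "real j / real N" 1 h] by auto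
    then show ?thesis by (auto simp: y_def node_def segment_def h_def)
  qed
  have M_nonneg: "0 \<le> M" using M[OF s] by linarith
  have mean: "(\<Sum>j\<le>N. (y j - s) * B j) = 0"
  proof -
    have "(\<Sum>j\<le>N. (y j - s) * B j) = h / N * ((\<Sum>j\<le>N. real j * B j) - N * u * (\<Sum>j\<le>N. B j))"
      unfolding y_minus_s by (simp add: sum_distrib_left sum_subtractf algebra_simps)
    then show ?thesis by (simp add: B_def)
  qed
  have variance: "(\<Sum>j\<le>N. (y j - s)\<^sup>2 * B j) = h\<^sup>2 * (u * (1 - u)) / N"
  proof -
    have "(\<Sum>j\<le>N. (y j - s)\<^sup>2 * B j) = (h / N)\<^sup>2 * (\<Sum>j\<le>N. (real j - real N * u)\<^sup>2 * B j)"
      unfolding y_minus_s power_mult_distrib by (simp add: sum_distrib_left mult.assoc)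
    also have "\<dots> = (h / N)\<^sup>2 * (N * u * (1 - u))" by (simp add: B_def sum_Bernstein_variance)
    finally show ?thesis using N by (simp add: power2_eq_square)
  qed
  have "bernstein_segment t N f k s = (\<Sum>j\<le>N. f (y j) * B j)"
    unfolding bernstein_segment_def atLeast0AtMost y_def B_def u_def h_def
    by (intro sum.cong) (simp_all add: bernstein_basis_eq_Bernstein[OF t])
  also have "\<dots> = (\<Sum>j\<le>N. R j * B j + f s * B j + f' s * ((y j - s) * B j))"
    by (intro sum.cong) (simp_all add: R_def algebra_simps)
  also have "\<dots> = (\<Sum>j\<le>N. R j * B j) + f s * (\<Sum>j\<le>N. B j) + f' s * (\<Sum>j\<le>N. (y j - s) * B j)"
    by (simp add: sum.distrib sum_distrib_left)
  \<comment> \<open>\<open>mean\<close> is applied while \<open>B\<close> is still folded; unfolding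
    \<open>B\<close> then exposes the total weight 1.\<close>
  also have "\<dots> = (\<Sum>j\<le>N. R j * B j) + f s" by (simp add: mean) (simp add: B_def)
  finally have "\<bar>bernstein_segment t N f k s - f s\<bar> = \<bar>\<Sum>j\<le>N. R j * B j\<bar>" by simp
  \<comment> \<open>Nonnegative weights let the remainder bound be averaged termwise.\<close>
  also have "\<dots> \<le> (\<Sum>j\<le>N. M / 2 * (y j - s)\<^sup>2 * B j)"
  proof (rule order_trans[OF sum_abs sum_mono])
    fix j assume "j \<in> {..N}"
    then have "\<bar>R j\<bar> \<le> M / 2 * (y j - s)\<^sup>2"
      unfolding R_def using f f' M s y_seg[of j]
      by (intro second_order_Taylor_bound[of "t (k - 1)" "t k" f f' f'']) (auto simp: segment_def)
    then show "\<bar>R j * B j\<bar> \<le> M / 2 * (y j - s)\<^sup>2 * B j"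
      using mult_right_mono[OF _ B_nonneg] B_nonneg[of j] by (simp only: abs_mult abs_of_nonneg)
  qed
  also have "\<dots> = M / 2 * (h\<^sup>2 * (u * (1 - u)) / N)"
    unfolding variance[symmetric] sum_distrib_left by (simp only: mult.assoc)
  \<comment> \<open>The maximum 1/4 of \<open>u * (1 - u)\<close>, times the Taylor factor 1/2,
    produces the constant 1/8.\<close>
  also have "\<dots> \<le> M / 2 * (h\<^sup>2 * (1 / 4) / N)"
  proof -
    have "0 \<le> (u - 1 / 2)\<^sup>2" by simp
    then have "u * (1 - u) \<le> 1 / 4" by (simp add: power2_eq_square algebra_simps)
    then show ?thesis using M_nonneg by (intro mult_left_mono divide_right_mono) auto
  qed
  finally show ?thesis by (simp add: h_def)
qed

lemma knots_mono:
  fixes t :: "nat \<Rightarrow> real"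
  assumes "\<And>k. k \<in> {1..K} \<Longrightarrow> t (k - 1) < t k" "i \<le> j" "j \<le> K"
  shows "t i \<le> t j"
  using assms(2,3)
proof (induction j rule: dec_induct)
  case (step j)
  then show ?case using assms(1)[of "Suc j"] by simp
qed simp

text \<open>Take the least \<open>k \<ge> 1\<close> with \<open>s \<le> t k\<close>. Minimality puts
  \<open>t (k - 1)\<close> below \<open>s\<close>, except for \<open>k = 1\<close>, where
  \<open>t 0 \<le> s\<close> is given.\<close>

lemma ex_segment:
  assumes "K \<ge> 1" and s: "s \<in> {t 0..t K}"
  shows "\<exists>k\<in>{1..K}. s \<in> segment t k"
proof -
  define k where "k = (LEAST k. 1 \<le> k \<and> s \<le> t k)"
  have k: "1 \<le> k \<and> s \<le> t k"
    unfolding k_def by (rule LeastI[of _ K]) (use assms in auto)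
  have "k \<le> K"
    unfolding k_def by (rule Least_le) (use assms in auto)
  moreover have "t (k - 1) \<le> s"
  proof (cases "k = 1")
    case False
    then have "\<not> (1 \<le> k - 1 \<and> s \<le> t (k - 1))"
      using k unfolding k_def by (intro not_less_Least) linarith
    moreover have "1 \<le> k - 1" using False k by linarith
    ultimately show ?thesis by simp
  qed (use s in simp)
  ultimately show ?thesis using k by (auto simp: segment_def)
qed

theorem lemma1:
  fixes K N :: nat and t :: "nat \<Rightarrow> real" and x :: "real \<Rightarrow> real" and t_f C_t A :: real
  assumes "K \<ge> 1" and "N \<ge> 1"
    and "C2_on {0..t_f} x"
    and "t 0 = 0" and "\<And>k. k \<in> {1..K} \<Longrightarrow> t (k - 1) < t k" and "t K = t_f"
    and "C_t > 0"
    and "\<And>k. k \<in> {1..K} \<Longrightarrow> \<bar>t k - t (k - 1)\<bar> \<le> C_t / real K"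
    and "A = C_t\<^sup>2 / 8 * max_abs_segments t K (deriv_on {0..t_f} (deriv_on {0..t_f} x))"
  shows "\<forall>s\<in>{0..t_f}. norm (composite_bernstein t K N x s - x s) \<le> A / ((real K)\<^sup>2 * real N)"
proof
  fix s assume s: "s \<in> {0..t_f}"
  define S where "S = {0..t_f}"
  define x' where "x' = deriv_on S x"
  define x'' where "x'' = deriv_on S x'"
  define M where "M = max_abs_segments t K x''"
  have C2: "x differentiable_on S" "x' differentiable_on S" "continuous_on S x''"
    using assms(3) by (auto simp: C2_on_def S_def x'_def x''_def)
  have segment_subset: "segment t j \<subseteq> S" if "j \<in> {1..K}" for j
    using knots_mono[of K t 0 "j - 1", OF assms(5)] knots_mono[of K t j K, OF assms(5)] that assms(4,6)
    by (auto simp: segment_def S_def)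
  obtain k where k: "k \<in> {1..K}" and sk: "s \<in> segment t k"
    using ex_segment[of K s t] s assms(1,4,6) by auto
  \<comment> \<open>Continuity of \<open>x''\<close> on the compact union of segments makes the
    supremum \<open>M\<close> an attained maximum, hence a true upper bound.\<close>
  have bound: "\<bar>x'' z\<bar> \<le> M" if "z \<in> segment t k" for z
    unfolding M_def
  proof (rule max_abs_segments_is_max(2)[OF assms(1,5) _ k that])
    show "continuous_on (\<Union>j\<in>{1..K}. segment t j) x''"
      using segment_subset by (intro continuous_on_subset[OF C2(3)] UN_least)
  qed
  have M_nonneg: "0 \<le> M" using bound[OF sk] by linarith
  \<comment> \<open>At an interior knot \<open>k\<close> may differ from the segment chosen in the
    definition; both give the same value.\<close>
  have "\<bar>composite_bernstein t K N x s - x s\<bar> = \<bar>bernstein_segment t N x k s - x s\<bar>"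
    using composite_bernstein_eq[OF assms(2,5) k sk] by simp
  also have "\<dots> \<le> M * (t k - t (k - 1))\<^sup>2 / (8 * real N)"
  \<comment> \<open>Derivatives within \<open>{0..t_f}\<close> restrict to the segment, where they
    become one-sided at its knots.\<close>
  proof (rule bernstein_segment_error[OF assms(2) assms(5)[OF k] _ _ bound sk])
    fix z assume z: "z \<in> segment t k"
    note sub = segment_subset[OF k]
    show "(x has_real_derivative x' z) (at z within segment t k)"
      unfolding x'_def using z sub C2(1)
      by (intro has_field_derivative_subset[OF has_real_derivative_deriv_on sub]) auto
    show "(x' has_real_derivative x'' z) (at z within segment t k)"
      unfolding x''_def using z sub C2(2)
      by (intro has_field_derivative_subset[OF has_real_derivative_deriv_on sub]) auto
  qed
  \<comment> \<open>Squaring the mesh bound is what yields the order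
    \<open>1 / K\<^sup>2\<close>.\<close>
  also have "\<dots> \<le> M * (C_t / real K)\<^sup>2 / (8 * real N)"
    using M_nonneg power_mono[OF assms(8)[OF k], of 2]
    by (intro divide_right_mono mult_left_mono) auto
  also have "\<dots> = A / ((real K)\<^sup>2 * real N)"
    unfolding assms(9) M_def x''_def x'_def S_def by (simp add: power_divide mult_ac)
  finally show "norm (composite_bernstein t K N x s - x s) \<le> A / ((real K)\<^sup>2 * real N)" by simp
qed

end
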